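(* Let $q$ be a complex number with $|q|<1$. Then \[ \sum_{k=0}^{\infty}\frac{(q;q)_k^2}{(q;q)_{2k+1}}\,q^{2\binom{k+1}{2}} =\frac{(q^3;q^3)_{\infty}^2}{(q;q^3)_\infty\,(q^2;q^3)_{\infty}}. \]
   Context: For complex $x,p$ with $|p|<1$ and integer $n\ge 0$: $(x;p)_\infty=\prod_{i=0}^{\infty}(1-xp^i)$ and $(x;p)_n=\prod_{i=0}^{n-1}(1-xp^i)$ (so $(x;p)_0=1$). *)

theory Defs
  imports "HOL-Analysis.Analysis"
begin

definition qpoch :: "complex \<Rightarrow> complex \<Rightarrow> nat \<Rightarrow> complex" where
  "qpoch x p n = (\<Prod>i<n. 1 - x * p ^ i)"

(* Only meaningful for norm p < 1, where the product converges (in the sense of has_prod,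
   which allows finitely many zero factors). *)
definition qpoch_inf :: "complex \<Rightarrow> complex \<Rightarrow> complex" where
  "qpoch_inf x p = (\<Prod>i. 1 - x * p ^ i)"

end

theory Submission
  imports Defs
begin

text \<open>
  Dividing the finite Jacobi triple product by \<open>1 - z\<close> and letting \<open>z\<close> tend to 1 expands
  \<open>(q;q)\<^sub>n\<^sup>2 / (q;q)\<^bsub>2n+1\<^esub>\<close> as the sum over \<open>r \<le> n\<close> of
  \<open>(-1)\<^sup>r (2r+1) q\<^bsup>r(r+1)/2\<^esup> / ((q;q)\<^bsub>n-r\<^esub> (q;q)\<^bsub>n+r+1\<^esub>)\<close>.
  Multiply by \<open>q\<^bsup>n(n+1)\<^esup>\<close>, sum over \<open>n\<close> and interchange the sums: without the factor
  \<open>(-1)\<^sup>r (2r+1) q\<^bsup>r(r+1)/2\<^esup>\<close>, the sum over \<open>n\<close> is the Durfee rectangle series, with value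
  \<open>q\<^bsup>r(r+1)\<^esup> / (q;q)\<^sub>\<infinity>\<close>. What remains is \<open>1 / (q;q)\<^sub>\<infinity>\<close> times the sum of
  \<open>(-1)\<^sup>r (2r+1) q\<^bsup>3r(r+1)/2\<^esup>\<close>. By Jacobi's identity, which is the limit \<open>n \<rightarrow> \<infinity>\<close> of
  the same expansion with \<open>q\<^sup>3\<close> for \<open>q\<close>, that sum is \<open>(q\<^sup>3;q\<^sup>3)\<^sub>\<infinity>\<^sup>3\<close>.
\<close>

section \<open>The finite expansion\<close>

lemma qpoch_Suc: "qpoch x p (Suc n) = qpoch x p n * (1 - x * p ^ n)"
  by (simp add: qpoch_def)

lemma Suc_choose_two: "Suc r choose 2 = (r choose 2) + r"
  by (simp add: numeral_2_eq_2)

lemma double_choose_two: "2 * (Suc k choose 2) = k * (k + 1)"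
  by (induction k) (auto simp: Suc_choose_two)

lemma one_minus_power_nonzero:
  fixes q :: complex
  assumes "norm q < 1"
  shows "1 - q ^ Suc n \<noteq> 0"
proof
  assume "1 - q ^ Suc n = 0"
  then have "norm (q ^ Suc n) = 1" by simp
  moreover have "norm (q ^ Suc n) < 1"
    using assms power_less_one_iff[of "norm q" "Suc n"] by (simp add: norm_power del: power_Suc)
  ultimately show False by simp
qed

text \<open>Applied repeatedly, this brings all inverse products to the largest index that occurs;
  the recurrences below then become polynomial identities in powers of \<open>q\<close>.\<close>

lemma inverse_qpoch_step:
  assumes "norm q < 1"
  shows "inverse (qpoch q q n) = (1 - q ^ Suc n) * inverse (qpoch q q (Suc n))"
  using one_minus_power_nonzero[OF assms, of n] by (simp add: qpoch_Suc)

text \<open>Multiplied by \<open>(q;q)\<^sub>2\<^sub>n\<^sub>+\<^sub>1\<close>, this is a signed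
  q-binomial coefficient from the finite triple product. The zero branch stands for 1/(q;q) at a
  negative index, where truncated subtraction would give 1 instead.\<close>

definition jsummand :: "complex \<Rightarrow> nat \<Rightarrow> nat \<Rightarrow> complex" where
  "jsummand q n r = (if r \<le> n then (-1) ^ r * q ^ (Suc r choose 2) *
     inverse (qpoch q q (n - r)) * inverse (qpoch q q (n + r + 1)) else 0)"

lemma jsummand_eqI:
  assumes "n = r + s" "m = 2 * r + s + 1" "t = Suc r choose 2"
  shows "jsummand q n r = (-1) ^ r * q ^ t * inverse (qpoch q q s) * inverse (qpoch q q m)"
  using assms by (simp add: jsummand_def mult_2 add_ac)

text \<open>Raising \<open>n\<close> by one multiplies the finite triple product by (1 - z q^(n+1))
  (1 - q^(n+1)/z) = 1 + q^(2n+2) - q^(n+1) (z + 1/z). This compares coefficients of a power of z;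
  the two factors on the left come from passing from (q;q) at 2n+1 to 2n+3.\<close>

lemma jsummand_rec:
  assumes q: "norm q < 1" and r: "Suc r \<le> n"
  shows "(1 - q ^ (2 * n + 2)) * (1 - q ^ (2 * n + 3)) * jsummand q (Suc n) (Suc r) =
    (1 + q ^ (2 * n + 2)) * jsummand q n (Suc r)
      - q ^ (n + 1) * (jsummand q n r + jsummand q n (Suc (Suc r)))"
proof -
  obtain s where n: "n = Suc r + s" using r le_Suc_ex by blast
  define A B where "A = inverse (qpoch q q (s + 1))" and "B = inverse (qpoch q q (2 * r + s + 4))"
  define S R where "S = q ^ s" and "R = q ^ r"
  note e = inverse_qpoch_step[OF q]
  have e0: "inverse (qpoch q q s) = (1 - q * S) * A"
    using e[of s] by (simp add: A_def S_def)
  have e1: "inverse (qpoch q q (2 * r + s + 3)) = (1 - q ^ 4 * R\<^sup>2 * S) * B"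
    using e[of "2 * r + s + 3"]
    by (simp add: B_def R_def S_def power_add power_mult power2_eq_square power_mult_distrib
        eval_nat_numeral mult_ac)
  have e2: "inverse (qpoch q q (2 * r + s + 2)) = (1 - q ^ 3 * R\<^sup>2 * S) * ((1 - q ^ 4 * R\<^sup>2 * S) * B)"
    using e[of "2 * r + s + 2"] e1
    by (simp add: R_def S_def power_add power_mult power2_eq_square power_mult_distrib
        eval_nat_numeral mult_ac)
  define T where "T = (-1) ^ r * q ^ (Suc r choose 2)"
  define t where "t = Suc r choose 2"
  define T where "T = (-1) ^ r * q ^ t"
  have t1: "Suc (Suc r) choose 2 = t + r + 1" and t2: "Suc (Suc (Suc r)) choose 2 = t + 2 * r + 3"
    by (simp_all add: t_def Suc_choose_two)
  have "jsummand q n r = (-1) ^ r * q ^ t * inverse (qpoch q q (s + 1)) * inverse (qpoch q q (2 * r + s + 2))"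
    by (rule jsummand_eqI) (simp_all add: n t_def)
  then have j0: "jsummand q n r = T * A * ((1 - q ^ 3 * R\<^sup>2 * S) * ((1 - q ^ 4 * R\<^sup>2 * S) * B))"
    by (simp only: e2 T_def A_def)
  have "jsummand q n (Suc r) = (-1) ^ Suc r * q ^ (t + r + 1) * inverse (qpoch q q s) *
      inverse (qpoch q q (2 * r + s + 3))"
    by (rule jsummand_eqI) (simp_all add: n t1)
  then have j1: "jsummand q n (Suc r) = - T * q * R * ((1 - q * S) * A) * ((1 - q ^ 4 * R\<^sup>2 * S) * B)"
    by (simp add: e0 e1 T_def R_def power_add)
  have "jsummand q (Suc n) (Suc r) = (-1) ^ Suc r * q ^ (t + r + 1) * inverse (qpoch q q (s + 1)) *
      inverse (qpoch q q (2 * r + s + 4))"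
    by (rule jsummand_eqI) (simp_all add: n t1)
  then have j1': "jsummand q (Suc n) (Suc r) = - T * q * R * A * B"
    by (simp add: T_def R_def A_def B_def power_add)
  \<comment> \<open>For s = 0 the index exceeds \<open>n\<close>, and the factor 1 - S = 0 agrees
    with the default value.\<close>
  have j2: "jsummand q n (Suc (Suc r)) = T * q ^ 3 * R\<^sup>2 * ((1 - S) * ((1 - q * S) * A)) * B"
  proof (cases s)
    case 0
    then show ?thesis by (simp add: jsummand_def n S_def)
  next
    case (Suc u)
    have e': "inverse (qpoch q q u) = (1 - S) * ((1 - q * S) * A)"
      using e[of u] e0 by (simp add: Suc S_def)
    have "jsummand q n (Suc (Suc r)) = (-1) ^ Suc (Suc r) * q ^ (t + 2 * r + 3) * inverse (qpoch q q u) *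
        inverse (qpoch q q (2 * r + s + 4))"
      by (rule jsummand_eqI) (simp_all add: n Suc t2)
    moreover have "q ^ (t + 2 * r + 3) = q ^ t * R\<^sup>2 * q ^ 3"
      unfolding R_def power_add power_mult[symmetric] by (simp only: mult.commute[of 2])
    ultimately show ?thesis
      by (simp add: e' T_def B_def)
  qed
  have pw: "q ^ (2 * n + 2) = q ^ 4 * R\<^sup>2 * S\<^sup>2" "q ^ (2 * n + 3) = q ^ 5 * R\<^sup>2 * S\<^sup>2"
      "q ^ (n + 1) = q\<^sup>2 * R * S"
    by (simp_all add: n R_def S_def power_add power_mult power2_eq_square power_mult_distrib
        eval_nat_numeral mult_ac)
  show ?thesis
    unfolding j0 j1 j1' j2 pw by algebra
qed

text \<open>
  The weights \<open>w r = 2r + 1\<close> satisfy \<open>w (r-1) + w (r+1) = 2 w r\<close>, so by the recurrence in \<open>n\<close>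
  the summands telescope in \<open>r\<close>.
\<close>
lemma jsummand_telescope:
  assumes q: "norm q < 1" and "N \<le> n"
  shows "(\<Sum>r\<le>N. of_nat (2 * r + 1) * ((1 - q ^ (2 * n + 2)) * (1 - q ^ (2 * n + 3)) * jsummand q (Suc n) r
            - (1 - q ^ (n + 1))\<^sup>2 * jsummand q n r)) =
     q ^ (n + 1) * (of_nat (2 * N + 3) * jsummand q n N - of_nat (2 * N + 1) * jsummand q n (Suc N))"
  using \<open>N \<le> n\<close>
proof (induction N)
  case 0
  note e = inverse_qpoch_step[OF q]
  define A B S where "A = inverse (qpoch q q (n + 1))" and "B = inverse (qpoch q q (n + 2))" and "S = q ^ n"
  have A: "A = (1 - q\<^sup>2 * S) * B"
    using e[of "n + 1"] by (simp add: A_def B_def S_def power2_eq_square mult_ac)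
  have e0: "inverse (qpoch q q n) = (1 - q * S) * A"
    using e[of n] by (simp add: A_def S_def)
  have tri: "Suc 0 choose 2 = 0" "Suc (Suc 0) choose 2 = 1"
    by (simp_all add: numeral_2_eq_2)
  have j0: "jsummand q n 0 = (1 - q * S) * A * A"
    by (simp add: jsummand_def tri e0) (simp add: A_def)
  have j0': "jsummand q (Suc n) 0 = A * B"
    by (simp add: jsummand_def tri A_def B_def)
  have j1: "jsummand q n (Suc 0) = - q * ((1 - S) * ((1 - q * S) * A)) * B"
  proof (cases n)
    case 0
    then show ?thesis by (simp add: jsummand_def S_def)
  next
    case (Suc u)
    have e': "inverse (qpoch q q u) = (1 - S) * ((1 - q * S) * A)"
      using e[of u] e0 by (simp add: Suc S_def)
    have "jsummand q n (Suc 0) = (-1) ^ Suc 0 * q ^ 1 * inverse (qpoch q q u) * inverse (qpoch q q (n + 2))"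
      by (rule jsummand_eqI) (simp_all add: Suc tri)
    then show ?thesis
      by (simp add: e' B_def)
  qed
  have pw: "q ^ (2 * n + 2) = q ^ 2 * S\<^sup>2" "q ^ (2 * n + 3) = q ^ 3 * S\<^sup>2"
      "q ^ (n + 1) = q * S"
    by (simp_all add: S_def power_add power_mult power2_eq_square power_mult_distrib
        eval_nat_numeral mult_ac)
  \<comment> \<open>At r = 0 the antisymmetry of the triple product puts minus the summand at 0 in
    place of the left neighbour, whence the coefficient 3 = 2 + 1.\<close>
  have "(1 - q ^ 2 * S\<^sup>2) * (1 - q ^ 3 * S\<^sup>2) * (A * B) - (1 - q * S)\<^sup>2 * ((1 - q * S) * A * A) =
      q * S * (3 * ((1 - q * S) * A * A) + q * ((1 - S) * ((1 - q * S) * A)) * B)"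
    unfolding A by algebra
  then show ?case
    unfolding pw by (simp add: j0 j0' j1)
next
  case (Suc N)
  let ?d = "\<lambda>r. (1 - q ^ (2 * n + 2)) * (1 - q ^ (2 * n + 3)) * jsummand q (Suc n) r
            - (1 - q ^ (n + 1))\<^sup>2 * jsummand q n r"
  \<comment> \<open>Subtracting this square instead of 1 + q^(2n+2) turns the recurrence into a
    second difference in \<open>r\<close>.\<close>
  have sq: "(1 - q ^ (n + 1))\<^sup>2 = 1 + q ^ (2 * n + 2) - 2 * q ^ (n + 1)"
  proof -
    have "q ^ (2 * n + 2) = (q ^ (n + 1))\<^sup>2"
      unfolding power_mult[symmetric] by (simp add: mult.commute)
    then show ?thesis by (simp only: power2_diff) simp
  qed
  have d: "?d (Suc N) = q ^ (n + 1) * (2 * jsummand q n (Suc N) - jsummand q n N - jsummand q n (Suc (Suc N)))"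
    unfolding sq jsummand_rec[OF q Suc.prems] by (simp only: ring_distribs) simp
  have IH: "(\<Sum>r\<le>N. of_nat (2 * r + 1) * ?d r) =
     q ^ (n + 1) * (of_nat (2 * N + 3) * jsummand q n N - of_nat (2 * N + 1) * jsummand q n (Suc N))"
    using Suc by simp
  have "(\<Sum>r\<le>Suc N. of_nat (2 * r + 1) * ?d r) =
     q ^ (n + 1) * (of_nat (2 * N + 3) * jsummand q n N - of_nat (2 * N + 1) * jsummand q n (Suc N))
     + of_nat (2 * Suc N + 1) *
       (q ^ (n + 1) * (2 * jsummand q n (Suc N) - jsummand q n N - jsummand q n (Suc (Suc N))))"
    by (simp only: sum.atMost_Suc IH d)
  also have "\<dots> = q ^ (n + 1) * (of_nat (2 * Suc N + 3) * jsummand q n (Suc N)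
      - of_nat (2 * Suc N + 1) * jsummand q n (Suc (Suc N)))"
    by (simp add: algebra_simps)
  finally show ?case .
qed

text \<open>Both sides satisfy ?a X(n+1) = ?b X(n). On the right, telescoping over r \<le> n leaves
  one boundary term, which the new top summand r = n+1 cancels.\<close>

lemma qpoch_square_expansion:
  assumes q: "norm q < 1"
  shows "(qpoch q q n)\<^sup>2 / qpoch q q (2 * n + 1) = (\<Sum>r\<le>n. of_nat (2 * r + 1) * jsummand q n r)"
proof (induction n)
  case 0
  show ?case by (simp add: jsummand_def qpoch_def field_simps binomial_eq_0)
next
  case (Suc n)
  let ?a = "(1 - q ^ (2 * n + 2)) * (1 - q ^ (2 * n + 3))"
  let ?b = "(1 - q ^ (n + 1))\<^sup>2"
  let ?f = "\<lambda>n r. of_nat (2 * r + 1) * jsummand q n r"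
  note e = inverse_qpoch_step[OF q]
  have nz: "?a \<noteq> 0"
    using one_minus_power_nonzero[OF q, of "2 * n + 1"] one_minus_power_nonzero[OF q, of "2 * n + 2"]
    by (simp add: eval_nat_numeral)
  have "(\<Sum>r\<le>n. ?a * ?f (Suc n) r) - ?b * (\<Sum>r\<le>n. ?f n r) =
      (\<Sum>r\<le>n. of_nat (2 * r + 1) * (?a * jsummand q (Suc n) r - ?b * jsummand q n r))"
    unfolding sum_distrib_left sum_subtractf[symmetric] by (intro sum.cong refl) (simp only: algebra_simps)
  \<comment> \<open>The other boundary term contains \<open>jsummand q n (Suc n)\<close>, which is 0
    by default.\<close>
  also have "\<dots> = q ^ (n + 1) * (of_nat (2 * n + 3) * jsummand q n n)"
    unfolding jsummand_telescope[OF q order.refl] by (simp add: jsummand_def)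
  finally have diff: "(\<Sum>r\<le>n. ?a * ?f (Suc n) r) - ?b * (\<Sum>r\<le>n. ?f n r) =
      q ^ (n + 1) * (of_nat (2 * n + 3) * jsummand q n n)" .
  have 1: "?a * (\<Sum>r\<le>n. ?f (Suc n) r) = ?b * (\<Sum>r\<le>n. ?f n r) +
      q ^ (n + 1) * (of_nat (2 * n + 3) * jsummand q n n)"
    using diff unfolding sum_distrib_left[of ?a] by (simp only: diff_eq_eq add.commute)
  have "inverse (qpoch q q (2 * n + 1)) = ?a * inverse (qpoch q q (2 * n + 3))"
    using e[of "2 * n + 1"] e[of "2 * n + 2"] by (simp add: eval_nat_numeral)
  moreover have "jsummand q n n = (-1) ^ n * q ^ (Suc n choose 2) * inverse (qpoch q q 0) *
      inverse (qpoch q q (2 * n + 1))"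
    by (rule jsummand_eqI) simp_all
  moreover have "jsummand q (Suc n) (Suc n) = (-1) ^ Suc n * q ^ ((Suc n choose 2) + (n + 1)) *
      inverse (qpoch q q 0) * inverse (qpoch q q (2 * n + 3))"
    by (rule jsummand_eqI) (simp_all add: Suc_choose_two)
  ultimately have "?a * jsummand q (Suc n) (Suc n) = - (q ^ (n + 1)) * jsummand q n n"
    by (simp add: power_add)
  then have "?a * ?f (Suc n) (Suc n) = of_nat (2 * Suc n + 1) * (- (q ^ (n + 1)) * jsummand q n n)"
    by (simp only: mult.left_commute[of ?a])
  also have "\<dots> = - (q ^ (n + 1) * (of_nat (2 * n + 3) * jsummand q n n))"
    by simp
  finally have 2: "?a * ?f (Suc n) (Suc n) = \<dots>" .
  have "?a * (\<Sum>r\<le>Suc n. ?f (Suc n) r) = ?b * (\<Sum>r\<le>n. ?f n r)"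
    unfolding sum.atMost_Suc distrib_left[of ?a] 1 2 by simp
  also have "\<dots> = ?b * ((qpoch q q n)\<^sup>2 / qpoch q q (2 * n + 1))"
    by (simp only: Suc.IH)
  also have "\<dots> = (qpoch q q (Suc n))\<^sup>2 / qpoch q q (2 * n + 1)"
    by (simp add: qpoch_Suc power_mult_distrib)
  also have "\<dots> = ?a * ((qpoch q q (Suc n))\<^sup>2 / qpoch q q (2 * Suc n + 1))"
    using e[of "2 * n + 1"] e[of "2 * n + 2"] by (simp add: eval_nat_numeral divide_inverse)
  finally show ?case unfolding mult_cancel_left using nz by simp
qed

section \<open>Limits of q-products\<close>

lemma Tannery_sequentially:
  fixes a :: "nat \<Rightarrow> nat \<Rightarrow> complex"
  assumes lim: "\<And>r. (\<lambda>n. a r n) \<longlonglongrightarrow> b r"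
    and bound: "\<And>r n. norm (a r n) \<le> M r" and M: "summable M"
  shows "summable b" "(\<lambda>n. \<Sum>r. a r n) \<longlonglongrightarrow> suminf b"
proof -
  have "eventually (\<lambda>(r, n). norm (a r n) \<le> M r) (at_top \<times>\<^sub>F sequentially)"
    by (intro always_eventually) (auto simp: bound)
  note * = tannerys_theorem[OF lim this M sequentially_bot]
  then show "summable b" using summable_norm_cancel by blast
  show "(\<lambda>n. \<Sum>r. a r n) \<longlonglongrightarrow> suminf b" using * by simp
qed

text \<open>Since row \<open>n\<close> vanishes beyond r = n, its finite sum is already a full
  series, so dominated convergence applies although the range grows.\<close>

lemma Tannery_triangle:
  fixes a :: "nat \<Rightarrow> nat \<Rightarrow> complex"
  assumes lim: "\<And>r. (\<lambda>n. a r n) \<longlonglongrightarrow> b r"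
    and bound: "\<And>r n. norm (a r n) \<le> M r" and M: "summable M"
    and zero: "\<And>r n. n < r \<Longrightarrow> a r n = 0"
  shows "(\<lambda>n. \<Sum>r\<le>n. a r n) \<longlonglongrightarrow> suminf b"
proof -
  have "(\<Sum>r. a r n) = (\<Sum>r\<le>n. a r n)" for n
    by (rule suminf_finite) (auto simp: zero)
  with Tannery_sequentially(2)[OF lim bound M] show ?thesis by simp
qed

context
  fixes x p :: complex
  assumes p: "norm p < 1"
begin

lemma convergent_prod_qpoch: "convergent_prod (\<lambda>i. 1 - x * p ^ i)"
proof -
  have "summable (\<lambda>i. norm x * norm p ^ i)"
    using p by (intro summable_mult summable_geometric) simp
  then show ?thesis
    by (intro abs_convergent_prod_imp_convergent_prod summable_imp_abs_convergent_prod)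
       (simp add: norm_mult norm_power)
qed

lemma qpoch_tendsto: "(\<lambda>n. qpoch x p n) \<longlonglongrightarrow> qpoch_inf x p"
  unfolding qpoch_def qpoch_inf_def
  using convergent_prod_LIMSEQ[OF convergent_prod_qpoch] by (simp add: LIMSEQ_lessThan_iff_atMost)

end

lemma qpoch_inf_self_nonzero: "norm q < 1 \<Longrightarrow> qpoch_inf q q \<noteq> 0"
  unfolding qpoch_inf_def using one_minus_power_nonzero[of q]
  by (intro prodinf_nonzero convergent_prod_qpoch) auto

text \<open>The inverses converge because the infinite product is nonzero. The constant
  \<open>C\<close> enters all the majorants below.\<close>

lemma inverse_qpoch_bounded:
  assumes "norm q < 1"
  obtains C where "C > 0" "\<And>n. norm (inverse (qpoch q q n)) \<le> C"
proof -
  have "(\<lambda>n. inverse (qpoch q q n)) \<longlonglongrightarrow> inverse (qpoch_inf q q)"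
    using assms by (intro tendsto_inverse qpoch_tendsto qpoch_inf_self_nonzero)
  then have "Bseq (\<lambda>n. inverse (qpoch q q n))"
    by (intro convergent_imp_Bseq convergentI)
  then show ?thesis using that by (auto elim: BseqE)
qed

section \<open>Durfee rectangles\<close>

text \<open>Generating function of the partitions whose largest rectangle with sides k and k + N has
  k = m.\<close>

definition durfee :: "complex \<Rightarrow> nat \<Rightarrow> nat \<Rightarrow> complex" where
  "durfee q N m = q ^ (m * (m + N)) * inverse (qpoch q q m) * inverse (qpoch q q (m + N))"

lemma norm_power_le:
  fixes q :: complex
  assumes "norm q < 1" "m \<le> k"
  shows "norm (q ^ k) \<le> norm q ^ m"
  using assms by (simp add: norm_power power_decreasing)

lemma norm_durfee_le:
  assumes q: "norm q < 1" and C: "\<And>n. norm (inverse (qpoch q q n)) \<le> C"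
  shows "norm (durfee q N m) \<le> norm q ^ m * C * C"
proof -
  have "m \<le> m * (m + N)" by (cases m) auto
  moreover have "C \<ge> 0" using C[of 0] norm_ge_zero order_trans by blast
  ultimately show ?thesis
    unfolding durfee_def norm_mult using q by (intro mult_mono C norm_power_le) auto
qed

lemma summable_durfee:
  assumes q: "norm q < 1"
  shows "summable (durfee q N)"
proof -
  obtain C where C: "\<And>n. norm (inverse (qpoch q q n)) \<le> C"
    using inverse_qpoch_bounded[OF q] by metis
  show ?thesis
  proof (rule summable_comparison_test)
    show "\<exists>k. \<forall>n\<ge>k. norm (durfee q N n) \<le> norm q ^ n * C * C"
      using norm_durfee_le[OF q C] by blast
    show "summable (\<lambda>n. norm q ^ n * C * C)"
      using q by (intro summable_mult2 summable_geometric) simp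
  qed
qed

text \<open>
  Iterating this contracts the difference of consecutive series to 0, so the series does not
  depend on \<open>N\<close> and equals its limit as \<open>N \<rightarrow> \<infinity>\<close>.
\<close>
lemma durfee_suminf_rec:
  assumes q: "norm q < 1"
  defines "D \<equiv> \<lambda>N. suminf (durfee q N)"
  shows "D N - D (N + 1) = - (q ^ (N + 1)) * (D (N + 1) - D (N + 2))"
proof -
  note e = inverse_qpoch_step[OF q]
  \<comment> \<open>The factor 1 - q^m makes h 0 vanish and cancels the last factor of (q;q) at m;
    shifting m by one then produces the series for N + 2.\<close>
  define h where "h m = q ^ (m * (m + N)) * (1 - q ^ m) * inverse (qpoch q q m) *
      inverse (qpoch q q (m + N + 1))" for m
  have term_eq: "durfee q N m - durfee q (N + 1) m + q ^ (N + 1) * durfee q (N + 1) m = h m" for m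
  proof -
    have "durfee q N m = q ^ (m * (m + N)) * inverse (qpoch q q m) *
        ((1 - q ^ (m + N + 1)) * inverse (qpoch q q (m + N + 1)))"
      using e[of "m + N"] by (simp add: durfee_def)
    moreover have "durfee q (N + 1) m = q ^ (m * (m + N)) * q ^ m * inverse (qpoch q q m) *
        inverse (qpoch q q (m + N + 1))"
      by (simp add: durfee_def power_add[symmetric] algebra_simps)
    moreover have "P * u * ((1 - X * Y * q ^ 1) * v) - P * X * u * v + Y * q ^ 1 * (P * X * u * v) =
        P * (1 - X) * u * v" for P X Y u v :: complex
      by algebra
    ultimately show ?thesis
      by (simp only: h_def power_add)
  qed
  have h_Suc: "h (Suc m) = q ^ (N + 1) * durfee q (N + 2) m" for m
  proof -
    have "h (Suc m) = q ^ (Suc m * (Suc m + N)) * ((1 - q ^ Suc m) * inverse (qpoch q q (Suc m))) *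
        inverse (qpoch q q (m + (N + 2)))"
      by (simp add: h_def)
    also have "Suc m * (Suc m + N) = (N + 1) + m * (m + (N + 2))"
      by (simp add: algebra_simps)
    finally show ?thesis
      unfolding e[symmetric] by (simp add: durfee_def power_add)
  qed
  have D: "durfee q M sums D M" for M
    unfolding D_def using summable_durfee[OF q] by (rule summable_sums)
  have "(\<lambda>m. h (Suc m)) sums (q ^ (N + 1) * D (N + 2))"
    unfolding h_Suc by (intro sums_mult D)
  then have "h sums (q ^ (N + 1) * D (N + 2))"
    using sums_Suc[of h] by (fastforce simp: h_def)
  moreover have "h sums (D N - D (N + 1) + q ^ (N + 1) * D (N + 1))"
    unfolding term_eq[symmetric] by (intro sums_add sums_diff sums_mult D)
  ultimately have "q ^ (N + 1) * D (N + 2) = D N - D (N + 1) + q ^ (N + 1) * D (N + 1)"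
    by (rule sums_unique2)
  then show ?thesis by (simp add: algebra_simps)
qed

text \<open>For m > 0 the factor q^(mN) sends the term to 0, so only m = 0 survives; the majorant in
  \<open>norm_durfee_le\<close> does not depend on \<open>N\<close>.\<close>

lemma durfee_suminf_tendsto:
  assumes q: "norm q < 1"
  shows "(\<lambda>N. suminf (durfee q N)) \<longlonglongrightarrow> inverse (qpoch_inf q q)"
proof -
  obtain C where C: "\<And>n. norm (inverse (qpoch q q n)) \<le> C"
    using inverse_qpoch_bounded[OF q] by metis
  define b where "b m = (if m = 0 then inverse (qpoch_inf q q) else 0)" for m :: nat
  have lim: "(\<lambda>N. inverse (qpoch q q (m + N))) \<longlonglongrightarrow> inverse (qpoch_inf q q)" for m
    using LIMSEQ_ignore_initial_segment[OF tendsto_inverse[OF qpoch_tendsto qpoch_inf_self_nonzero], OF q q, of m]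
    by (simp add: add.commute)
  have "(\<lambda>N. durfee q N m) \<longlonglongrightarrow> b m" for m
  proof (cases "m = 0")
    case True
    then show ?thesis using lim[of 0] by (simp add: durfee_def b_def qpoch_def[of _ _ 0])
  next
    case False
    have "norm (q ^ m) < 1"
      using q False by (simp add: norm_power power_less_one_iff)
    then have "(\<lambda>N. (q ^ m) ^ N) \<longlonglongrightarrow> 0" by (rule LIMSEQ_power_zero)
    then have "(\<lambda>N. q ^ (m * m) * (q ^ m) ^ N * inverse (qpoch q q m) * inverse (qpoch q q (m + N)))
        \<longlonglongrightarrow> q ^ (m * m) * 0 * inverse (qpoch q q m) * inverse (qpoch_inf q q)"
      by (intro tendsto_mult tendsto_const lim)
    then show ?thesis
      using False by (simp add: durfee_def b_def power_add power_mult distrib_left)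
  qed
  moreover have "summable (\<lambda>m. norm q ^ m * C * C)"
    using q by (intro summable_mult2 summable_geometric) simp
  ultimately have "(\<lambda>N. suminf (durfee q N)) \<longlonglongrightarrow> suminf b"
    by (intro Tannery_sequentially(2)[OF _ norm_durfee_le[OF q C]])
  moreover have "suminf b = inverse (qpoch_inf q q)"
    using suminf_finite[of "{0}" b] by (simp add: b_def)
  ultimately show ?thesis by simp
qed

lemma durfee_sums:
  assumes q: "norm q < 1"
  shows "durfee q N sums inverse (qpoch_inf q q)"
proof -
  define D where "D = (\<lambda>N. suminf (durfee q N))"
  have D_lim: "D \<longlonglongrightarrow> inverse (qpoch_inf q q)"
    unfolding D_def by (rule durfee_suminf_tendsto[OF q])
  define \<delta> where "\<delta> N = norm (D N - D (N + 1))" for N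
  \<comment> \<open>The recurrence makes these distances nondecreasing, yet they tend to 0 and are
    nonnegative; hence all of them are 0.\<close>
  have "\<delta> N \<le> \<delta> (Suc N)" for N
  proof -
    have "\<delta> N = norm q ^ (N + 1) * \<delta> (Suc N)"
      using durfee_suminf_rec[OF q, of N]
      by (simp add: \<delta>_def D_def norm_mult norm_power)
    also have "\<dots> \<le> 1 * \<delta> (Suc N)"
      using q by (intro mult_right_mono power_le_one) (auto simp: \<delta>_def)
    finally show ?thesis by simp
  qed
  then have "incseq \<delta>" by (rule incseq_SucI)
  moreover have "\<delta> \<longlonglongrightarrow> norm (inverse (qpoch_inf q q) - inverse (qpoch_inf q q))"
    unfolding \<delta>_def by (intro tendsto_norm tendsto_diff D_lim LIMSEQ_ignore_initial_segment)
  ultimately have "\<delta> N \<le> 0" for N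
    using incseq_le[of \<delta> 0 N] by simp
  then have "D (Suc N) = D N" for N
    by (simp add: \<delta>_def)
  then have "D N = D 0" for N
    by (induction N) simp_all
  then have "D = (\<lambda>_. D N)" by metis
  with D_lim have "D N = inverse (qpoch_inf q q)"
    by (metis LIMSEQ_const_iff)
  then show ?thesis
    using summable_sums[OF summable_durfee[OF q, of N]] by (simp add: D_def)
qed

section \<open>Jacobi's identity and the interchange of sums\<close>

lemma summable_odd_power:
  fixes t :: real
  assumes "0 \<le> t" "t < 1"
  shows "summable (\<lambda>r. of_nat (2 * r + 1) * t ^ r)"
proof (rule summable_comparison_test)
  show "\<exists>N. \<forall>r\<ge>N. norm (of_nat (2 * r + 1) * t ^ r) \<le> 2 * (of_nat (Suc r) * t ^ r)"
    using assms(1) by (intro exI[of _ 0] allI impI) (simp add: algebra_simps)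
  show "summable (\<lambda>r. 2 * (of_nat (Suc r) * t ^ r))"
    using geometric_deriv_sums[of t] assms by (intro summable_mult) (auto simp: sums_iff)
qed

lemma norm_jsummand_le:
  assumes q: "norm q < 1" and C: "\<And>n. norm (inverse (qpoch q q n)) \<le> C"
  shows "norm (jsummand q n r) \<le> norm q ^ r * C * C"
proof -
  have C0: "C \<ge> 0" using C[of 0] norm_ge_zero order_trans by blast
  have "r \<le> Suc r choose 2" by (simp add: Suc_choose_two)
  then have "norm ((-1) ^ r * q ^ (Suc r choose 2)) \<le> norm q ^ r"
    using norm_power_le[OF q] by (simp add: norm_mult norm_power)
  then show ?thesis
    using C0 C unfolding jsummand_def by (auto simp only: norm_mult split: if_split intro!: mult_mono) auto
qed

text \<open>In the finite expansion the left side tends to E^2/E = E, and each summand tends to its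
  numerator over E^2. Multiplying by E^2 gives the cube.\<close>

lemma jacobi_cube:
  assumes q: "norm q < 1"
  shows "(\<lambda>r. of_nat (2 * r + 1) * ((-1) ^ r * q ^ (Suc r choose 2))) sums (qpoch_inf q q) ^ 3"
proof -
  define E where "E = qpoch_inf q q"
  have E: "E \<noteq> 0" using qpoch_inf_self_nonzero[OF q] by (simp add: E_def)
  obtain C where C: "\<And>n. norm (inverse (qpoch q q n)) \<le> C"
    using inverse_qpoch_bounded[OF q] by metis
  let ?c = "\<lambda>r. (-1) ^ r * q ^ (Suc r choose 2)"
  define b where "b r = of_nat (2 * r + 1) * (?c r * inverse E * inverse E)" for r
  have lim: "(\<lambda>n. qpoch q q n) \<longlonglongrightarrow> E"
    unfolding E_def by (rule qpoch_tendsto[OF q])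
  have "(\<lambda>n. jsummand q n r) \<longlonglongrightarrow> ?c r * inverse E * inverse E" for r
  \<comment> \<open>Starting at n = r avoids the zero branch and the truncated subtraction.\<close>
  proof (rule LIMSEQ_offset[of _ r])
    have "(\<lambda>n. qpoch q q (n + (2 * r + 1))) \<longlonglongrightarrow> E"
      by (rule LIMSEQ_ignore_initial_segment[OF lim])
    then have "(\<lambda>n. ?c r * inverse (qpoch q q n) * inverse (qpoch q q (n + (2 * r + 1))))
        \<longlonglongrightarrow> ?c r * inverse E * inverse E"
      by (intro tendsto_mult tendsto_const tendsto_inverse lim E)
    then show "(\<lambda>n. jsummand q (n + r) r) \<longlonglongrightarrow> ?c r * inverse E * inverse E"
      by (simp add: jsummand_def mult_2 add_ac)
  qed
  then have lims: "(\<lambda>n. of_nat (2 * r + 1) * jsummand q n r) \<longlonglongrightarrow> b r" for r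
    unfolding b_def by (intro tendsto_mult_left)
  have bound: "norm (of_nat (2 * r + 1) * jsummand q n r) \<le> of_nat (2 * r + 1) * norm q ^ r * (C * C)" for n r
    unfolding norm_mult norm_of_nat mult.assoc
    using norm_jsummand_le[OF q C, of n r] by (intro mult_left_mono) (simp_all add: mult.assoc)
  have M: "summable (\<lambda>r. of_nat (2 * r + 1) * norm q ^ r * (C * C))"
    using q by (intro summable_mult2 summable_odd_power) auto
  have "summable b"
    using lims bound M by (rule Tannery_sequentially(1))
  have "(\<lambda>n. \<Sum>r\<le>n. of_nat (2 * r + 1) * jsummand q n r) \<longlonglongrightarrow> suminf b"
    using lims bound M by (rule Tannery_triangle) (simp add: jsummand_def)
  then have "(\<lambda>n. (qpoch q q n)\<^sup>2 / qpoch q q (2 * n + 1)) \<longlonglongrightarrow> suminf b"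
    unfolding qpoch_square_expansion[OF q] .
  moreover have "(\<lambda>n. (qpoch q q n)\<^sup>2 / qpoch q q (2 * n + 1)) \<longlonglongrightarrow> E\<^sup>2 / E"
  proof (intro tendsto_divide tendsto_power lim E)
    have "strict_mono (\<lambda>n::nat. 2 * n + 1)" by (rule strict_monoI) simp
    then show "(\<lambda>n. qpoch q q (2 * n + 1)) \<longlonglongrightarrow> E"
      using LIMSEQ_subseq_LIMSEQ[OF lim] by (simp add: o_def)
  qed
  ultimately have "suminf b = E\<^sup>2 / E" by (rule LIMSEQ_unique)
  with \<open>summable b\<close> have "b sums E"
    using E by (simp add: sums_iff power2_eq_square)
  then have "(\<lambda>r. b r * E\<^sup>2) sums (E * E\<^sup>2)" by (rule sums_mult2)
  moreover have "b r * E\<^sup>2 = of_nat (2 * r + 1) * ?c r" for r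
    using E by (simp add: b_def power2_eq_square field_simps)
  ultimately show ?thesis
    by (simp add: E_def power2_eq_square power3_eq_cube mult.assoc)
qed

text \<open>With n = m + r, n(n+1) = m(m+2r+1) + r(r+1). The first part belongs to the Durfee term
  with N = 2r+1; the second joins q^(r(r+1)/2) to give the power of q^3.\<close>

lemma jsummand_column_sums:
  assumes q: "norm q < 1"
  shows "(\<lambda>n. q ^ (n * (n + 1)) * jsummand q n r) sums
    ((-1) ^ r * (q ^ 3) ^ (Suc r choose 2) * inverse (qpoch_inf q q))"
proof -
  have "q ^ ((m + r) * (m + r + 1)) * jsummand q (m + r) r =
      (-1) ^ r * (q ^ 3) ^ (Suc r choose 2) * durfee q (2 * r + 1) m" for m
  proof -
    have "(m + r) * (m + r + 1) = m * (m + (2 * r + 1)) + 2 * (Suc r choose 2)"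
      unfolding double_choose_two by (simp add: algebra_simps)
    then have "q ^ ((m + r) * (m + r + 1)) = q ^ (m * (m + (2 * r + 1))) * (q ^ (Suc r choose 2))\<^sup>2"
      by (simp only: power_add power_mult mult.commute[of 2])
    moreover have "jsummand q (m + r) r = (-1) ^ r * q ^ (Suc r choose 2) * inverse (qpoch q q m) *
        inverse (qpoch q q (m + (2 * r + 1)))"
      by (rule jsummand_eqI) simp_all
    moreover have "(q ^ 3) ^ (Suc r choose 2) = (q ^ (Suc r choose 2)) ^ 3"
      by (simp only: power_mult[symmetric] mult.commute)
    moreover have "P * X\<^sup>2 * (c * X * u * v) = c * X ^ 3 * (P * u * v)" for P X c u v :: complex
      by algebra
    ultimately show ?thesis
      by (simp only: durfee_def)
  qed
  then have "(\<lambda>m. q ^ ((m + r) * (m + r + 1)) * jsummand q (m + r) r) sums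
      ((-1) ^ r * (q ^ 3) ^ (Suc r choose 2) * inverse (qpoch_inf q q))"
    by (simp only: sums_mult durfee_sums[OF q])
  \<comment> \<open>The terms with n < r vanish, so the shift by \<open>r\<close> loses
    nothing.\<close>
  then show ?thesis
    by (subst (asm) sums_zero_iff_shift) (simp_all add: jsummand_def)
qed

text \<open>The factors 1 - q^j are sorted by j modulo 3, first in the finite product of length 3n
  and then in the limit.\<close>

lemma qpoch_inf_trisect:
  assumes q: "norm q < 1"
  shows "qpoch_inf q q = qpoch_inf q (q ^ 3) * qpoch_inf (q ^ 2) (q ^ 3) * qpoch_inf (q ^ 3) (q ^ 3)"
proof -
  have q3: "norm (q ^ 3) < 1"
    using q by (simp add: norm_power power_less_one_iff)
  have "qpoch q q (3 * n) = qpoch q (q ^ 3) n * qpoch (q ^ 2) (q ^ 3) n * qpoch (q ^ 3) (q ^ 3) n" for n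
  proof (induction n)
    case (Suc n)
    have "qpoch q q (3 * Suc n) = qpoch q q (3 * n) *
        ((1 - q * (q ^ 3) ^ n) * (1 - q ^ 2 * (q ^ 3) ^ n) * (1 - q ^ 3 * (q ^ 3) ^ n))"
    proof -
      have "3 * Suc n = Suc (Suc (Suc (3 * n)))" by simp
      then show ?thesis
        by (simp only: qpoch_Suc power_Suc power_mult power2_eq_square power3_eq_cube mult.assoc)
    qed
    then show ?case
      by (simp only: Suc.IH qpoch_Suc) (simp only: mult_ac)
  qed (simp add: qpoch_def)
  moreover have "(\<lambda>n. qpoch q (q ^ 3) n * qpoch (q ^ 2) (q ^ 3) n * qpoch (q ^ 3) (q ^ 3) n)
      \<longlonglongrightarrow> qpoch_inf q (q ^ 3) * qpoch_inf (q ^ 2) (q ^ 3) * qpoch_inf (q ^ 3) (q ^ 3)"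
    by (intro tendsto_mult qpoch_tendsto q3)
  ultimately have "(\<lambda>n. qpoch q q (3 * n))
      \<longlonglongrightarrow> qpoch_inf q (q ^ 3) * qpoch_inf (q ^ 2) (q ^ 3) * qpoch_inf (q ^ 3) (q ^ 3)"
    by simp
  moreover have "(\<lambda>n. qpoch q q (3 * n)) \<longlonglongrightarrow> qpoch_inf q q"
  proof -
    have "strict_mono (\<lambda>n::nat. 3 * n)" by (rule strict_monoI) simp
    then show ?thesis
      using LIMSEQ_subseq_LIMSEQ[OF qpoch_tendsto[OF q]] by (simp add: o_def)
  qed
  ultimately show ?thesis by (metis LIMSEQ_unique)
qed

theorem theorem2p4:
  fixes q :: complex
  assumes "norm q < 1"
  shows "(\<lambda>k. (qpoch q q k)\<^sup>2 / qpoch q q (2 * k + 1) * q ^ (2 * ((k + 1) choose 2)))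
           sums ((qpoch_inf (q ^ 3) (q ^ 3))\<^sup>2 / (qpoch_inf q (q ^ 3) * qpoch_inf (q ^ 2) (q ^ 3)))"
proof -
  note q = assms
  have q3: "norm (q ^ 3) < 1"
    using q by (simp add: norm_power power_less_one_iff)
  define E where "E = qpoch_inf q q"
  obtain C where C: "\<And>n. norm (inverse (qpoch q q n)) \<le> C"
    using inverse_qpoch_bounded[OF q] by metis
  have C0: "C \<ge> 0" using C[of 0] norm_ge_zero order_trans by blast
  let ?c = "\<lambda>r. (-1) ^ r * (q ^ 3) ^ (Suc r choose 2)"
  \<comment> \<open>Weighted column sums truncated at \<open>L\<close>: only finite sums are
    swapped, and the interchange of the infinite ones becomes a limit in \<open>L\<close>.\<close>
  define a where "a r L = of_nat (2 * r + 1) * (\<Sum>n\<le>L. q ^ (n * (n + 1)) * jsummand q n r)" for r L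
  have partial: "(\<Sum>k\<le>L. (qpoch q q k)\<^sup>2 / qpoch q q (2 * k + 1) * q ^ (2 * ((k + 1) choose 2))) =
      (\<Sum>r\<le>L. a r L)" for L
  proof -
    have "(qpoch q q k)\<^sup>2 / qpoch q q (2 * k + 1) * q ^ (2 * ((k + 1) choose 2)) =
        (\<Sum>r\<le>L. of_nat (2 * r + 1) * (q ^ (k * (k + 1)) * jsummand q k r))" if "k \<le> L" for k
    proof -
      \<comment> \<open>Padding with zeros up to \<open>L\<close> makes the inner range independent
        of \<open>k\<close>, so the triangle becomes a square.\<close>
      have "(\<Sum>r\<le>k. of_nat (2 * r + 1) * jsummand q k r) = (\<Sum>r\<le>L. of_nat (2 * r + 1) * jsummand q k r)"
        using that by (intro sum.mono_neutral_left) (auto simp: jsummand_def)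
      moreover have "2 * ((k + 1) choose 2) = k * (k + 1)"
        using double_choose_two[of k] by simp
      ultimately show ?thesis
        by (simp only: qpoch_square_expansion[OF q] sum_distrib_right) (simp only: mult_ac)
    qed
    then have "(\<Sum>k\<le>L. (qpoch q q k)\<^sup>2 / qpoch q q (2 * k + 1) * q ^ (2 * ((k + 1) choose 2))) =
        (\<Sum>k\<le>L. \<Sum>r\<le>L. of_nat (2 * r + 1) * (q ^ (k * (k + 1)) * jsummand q k r))"
      by (intro sum.cong) auto
    also have "\<dots> = (\<Sum>r\<le>L. a r L)"
      unfolding a_def sum_distrib_left by (rule sum.swap)
    finally show ?thesis .
  qed
  have lims: "a r \<longlonglongrightarrow> of_nat (2 * r + 1) * (?c r * inverse E)" for r
    unfolding a_def E_def using jsummand_column_sums[OF q, of r]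
    by (intro tendsto_mult_left) (simp only: sums_def_le)
  \<comment> \<open>The power q^(n(n+1)) supplies |q|^n, summed over \<open>n\<close> by the
    geometric series, and the summand supplies |q|^r; the bound is thus uniform in
    \<open>L\<close>.\<close>
  have bound: "norm (a r L) \<le> of_nat (2 * r + 1) * norm q ^ r * (C * C * (1 / (1 - norm q)))" for r L
  proof -
    have "norm (\<Sum>n\<le>L. q ^ (n * (n + 1)) * jsummand q n r) \<le> (\<Sum>n\<le>L. norm q ^ n * (norm q ^ r * C * C))"
      unfolding norm_mult
      by (intro sum_norm_le) (auto simp only: norm_mult intro!: mult_mono norm_power_le q norm_jsummand_le C, auto)
    also have "\<dots> = (\<Sum>n\<le>L. norm q ^ n) * (norm q ^ r * C * C)"
      by (simp add: sum_distrib_right)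
    also have "\<dots> \<le> 1 / (1 - norm q) * (norm q ^ r * C * C)"
    proof (intro mult_right_mono)
      have "(\<Sum>n\<le>L. norm q ^ n) \<le> (\<Sum>n. norm q ^ n)"
        using q by (intro sum_le_suminf summable_geometric) auto
      then show "(\<Sum>n\<le>L. norm q ^ n) \<le> 1 / (1 - norm q)"
        using q by (simp add: suminf_geometric)
    qed (use C0 in auto)
    finally have "norm (a r L) \<le> of_nat (2 * r + 1) * (1 / (1 - norm q) * (norm q ^ r * C * C))"
      unfolding a_def norm_mult norm_of_nat by (intro mult_left_mono) auto
    then show ?thesis by (simp only: mult_ac)
  qed
  have M: "summable (\<lambda>r. of_nat (2 * r + 1) * norm q ^ r * (C * C * (1 / (1 - norm q))))"
    using q by (intro summable_mult2 summable_odd_power) auto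
  have zero: "a r L = 0" if "L < r" for r L
    using that by (auto simp: a_def jsummand_def intro!: sum.neutral)
  have "(\<lambda>L. \<Sum>r\<le>L. a r L) \<longlonglongrightarrow> (\<Sum>r. of_nat (2 * r + 1) * (?c r * inverse E))"
    using lims bound M zero by (rule Tannery_triangle)
  also have "(\<Sum>r. of_nat (2 * r + 1) * (?c r * inverse E)) = (qpoch_inf (q ^ 3) (q ^ 3)) ^ 3 * inverse E"
    using sums_mult2[OF jacobi_cube[OF q3], of "inverse E"]
    by (intro sums_unique[symmetric]) (simp only: mult.assoc)
  \<comment> \<open>Splitting E modulo 3 cancels one factor of the cube.\<close>
  also have "\<dots> = (qpoch_inf (q ^ 3) (q ^ 3))\<^sup>2 / (qpoch_inf q (q ^ 3) * qpoch_inf (q ^ 2) (q ^ 3))"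
    using qpoch_inf_self_nonzero[OF q3] unfolding E_def qpoch_inf_trisect[OF q]
    by (simp add: divide_inverse power3_eq_cube power2_eq_square mult_ac)
  finally show ?thesis
    unfolding sums_def_le partial .
qed

end
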